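(* Let $\epsilon>0$ and let $K$ be any policy with finite $C(K)$. Let $C^{l}(K)=\mathbb E_{\omega(0)\sim\pi,\,x_0\sim D}\Big[\sum_{t=0}^{l-1}x_t^\top Q_{\omega(t)}x_t+u_t^\top R_{\omega(t)}u_t\Big]$ be the cost of $K$ truncated at horizon $l$. If $$l\ \ge\ \frac{d\cdot C(K)^2\,\Big(\sum_{i=1}^{N_s}\big(\|Q_i\|+\|R_i\|\,\|K_i\|^2\big)\Big)}{\epsilon\,\mu\,\Lambda_{\min}(Q)^2},$$ then $C(K)-C^{l}(K)\le\epsilon$.
   Context: Setting (Markovian jump linear system). Let $\Omega=\{1,\dots,N_s\}$ and let $\omega(t)$, $t\ge0$, be a time-homogeneous Markov chain on $\Omega$ with transition probabilities $p_{ij}=\mathbb P(\omega(t+1)=j\mid\omega(t)=i)$ and initial distribution $\pi$. The state $x_t\in\mathbb R^d$ and control $u_t\in\mathbb R^k$ satisfy $x_{t+1}=A_{\omega(t)}x_t+B_{\omega(t)}u_t$, with $A_i\in\mathbb R^{d\times d}$, $B_i\in\mathbb R^{d\times k}$ and $x_0\sim D$ independent of the chain. A policy is a tuple $K=(K_1,\dots,K_{N_s})$, $K_i\in\mathbb R^{k\times d}$, acting by $u_t=-K_{\omega(t)}x_t$; its cost is $C(K)=\mathbb E_{x_0\sim D,\,\omega(0)\sim\pi}\big[\sum_{t=0}^\infty x_t^\top Q_{\omega(t)}x_t+u_t^\top R_{\omega(t)}u_t\big]$. Standing assumptions: all $Q_i\succ0$, all $R_i\succ0$, all $\pi_i>0$,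 $\mathbb E_{x_0\sim D}[x_0x_0^\top]\succ0$, and the system can be mean-square stabilized. Notation: $\|\cdot\|$ is the maximal singular value, $\Lambda_{\min}(Q)=\min_i\sigma_{\min}(Q_i)$, and $\mu=\min_i\pi_i\cdot\sigma_{\min}(\mathbb E_{x_0\sim D}[x_0x_0^\top])$. *)

theory Defs
  imports "HOL-Probability.Probability"
begin

definition positive_definite :: "real^'n^'n \<Rightarrow> bool" where
  "positive_definite A \<longleftrightarrow> transpose A = A \<and> (\<forall>x. x \<noteq> 0 \<longrightarrow> 0 < x \<bullet> (A *v x))"

text \<open>
  The singular values are the square roots of the eigenvalues of the Gram matrix of \<open>A\<close>. For a
  matrix with more columns than rows this convention adds the value 0 to the list, which does not
  affect the largest singular value; the smallest one is only used for square matrices.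
\<close>

definition singular_values :: "real^'n^'m \<Rightarrow> real set" where
  "singular_values A =
     {sqrt e | e. \<exists>v. v \<noteq> 0 \<and> (transpose A ** A) *v v = e *\<^sub>R v}"

definition sigma_max :: "real^'n^'m \<Rightarrow> real" where
  "sigma_max A = Max (singular_values A)"

definition sigma_min :: "real^'n^'n \<Rightarrow> real" where
  "sigma_min A = Min (singular_values A)"

definition second_moment :: "(real^'n) measure \<Rightarrow> real^'n^'n" where
  "second_moment D = (\<integral>x. columnvector x ** (rowvector x :: real^'n^1) \<partial>D)"

text \<open>
  Transition probabilities are only constrained by conditioning on histories of positive
  probability, since \<^const>\<open>cond_prob\<close> yields 0 when conditioning on a null event.
\<close>

definition markov_chain ::
  "'w measure \<Rightarrow> (nat \<Rightarrow> 'w \<Rightarrow> 's::finite) \<Rightarrow> ('s \<Rightarrow> real) \<Rightarrow> ('s \<Rightarrow> 's \<Rightarrow> real) \<Rightarrow> bool"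
where
  "markov_chain M \<omega> \<pi> p \<longleftrightarrow>
     prob_space M \<and>
     (\<forall>t. \<omega> t \<in> measurable M (count_space UNIV)) \<and>
     (\<forall>i j. 0 \<le> p i j) \<and> (\<forall>i. (\<Sum>j\<in>UNIV. p i j) = 1) \<and>
     (\<forall>i. \<P>(w in M. \<omega> 0 w = i) = \<pi> i) \<and>
     (\<forall>t s j. 0 < \<P>(w in M. \<forall>r\<le>t. \<omega> r w = s r) \<longrightarrow>
        \<P>(w in M. \<omega> (Suc t) w = j \<bar> \<forall>r\<le>t. \<omega> r w = s r) = p (s t) j)"

text \<open>
  The library notion \<open>indep_var\<close> needs both random variables to take values in the same type;
  this is its characterization by independence of the generated \<open>\<sigma>\<close>-algebras.
\<close>

definition independent_rvs ::
  "'w measure \<Rightarrow> 'a measure \<Rightarrow> ('w \<Rightarrow> 'a) \<Rightarrow> 'b measure \<Rightarrow> ('w \<Rightarrow> 'b) \<Rightarrow> bool"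
where
  "independent_rvs M S X T Y \<longleftrightarrow>
     X \<in> measurable M S \<and> Y \<in> measurable M T \<and>
     prob_space.indep_set M
       (sets (vimage_algebra (space M) X S)) (sets (vimage_algebra (space M) Y T))"

definition feedback :: "('s \<Rightarrow> real^'d^'k) \<Rightarrow> 's \<Rightarrow> real^'d \<Rightarrow> real^'k" where
  "feedback K i x = - (K i *v x)"

text \<open>The closed-loop trajectory along a fixed mode path \<open>s\<close> from the initial state \<open>x\<close>.\<close>

primrec trajectory ::
  "('s \<Rightarrow> real^'d^'d) \<Rightarrow> ('s \<Rightarrow> real^'k^'d) \<Rightarrow> ('s \<Rightarrow> real^'d^'k) \<Rightarrow>
   (nat \<Rightarrow> 's) \<Rightarrow> real^'d \<Rightarrow> nat \<Rightarrow> real^'d"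
where
  "trajectory A B K s x 0 = x"
| "trajectory A B K s x (Suc t) =
     A (s t) *v trajectory A B K s x t + B (s t) *v feedback K (s t) (trajectory A B K s x t)"

text \<open>
  Mean-square stability is required from every deterministic initial state and mode. The chain
  lives on an arbitrary probability measure on the type of mode paths: this type carries a chain
  for every stochastic matrix \<open>p\<close>, and the expectations only depend on the law of the chain.
\<close>

definition mean_square_stable ::
  "('s::finite \<Rightarrow> real^'d^'d) \<Rightarrow> ('s \<Rightarrow> real^'k^'d) \<Rightarrow> ('s \<Rightarrow> 's \<Rightarrow> real) \<Rightarrow>
   ('s \<Rightarrow> real^'d^'k) \<Rightarrow> bool"
where
  "mean_square_stable A B p K \<longleftrightarrow>
     (\<forall>x i (M :: (nat \<Rightarrow> 's) measure) \<omega>. markov_chain M \<omega> (\<lambda>j. of_bool (j = i)) p \<longrightarrow>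
        (\<lambda>t. \<integral>w. (norm (trajectory A B K (\<lambda>r. \<omega> r w) x t))\<^sup>2 \<partial>M) \<longlonglongrightarrow> 0)"

definition mean_square_stabilizable ::
  "('s::finite \<Rightarrow> real^'d^'d) \<Rightarrow> ('s \<Rightarrow> real^'k^'d) \<Rightarrow> ('s \<Rightarrow> 's \<Rightarrow> real) \<Rightarrow> bool"
where
  "mean_square_stabilizable A B p \<longleftrightarrow> (\<exists>K. mean_square_stable A B p K)"

definition stage_cost ::
  "('s \<Rightarrow> real^'d^'d) \<Rightarrow> ('s \<Rightarrow> real^'k^'k) \<Rightarrow> 's \<Rightarrow> real^'d \<Rightarrow> real^'k \<Rightarrow> real"
where
  "stage_cost Q R i x u = x \<bullet> (Q i *v x) + u \<bullet> (R i *v u)"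

definition path_stage_cost ::
  "('s \<Rightarrow> real^'d^'d) \<Rightarrow> ('s \<Rightarrow> real^'k^'d) \<Rightarrow> ('s \<Rightarrow> real^'d^'d) \<Rightarrow> ('s \<Rightarrow> real^'k^'k) \<Rightarrow>
   ('s \<Rightarrow> real^'d^'k) \<Rightarrow> (nat \<Rightarrow> 's) \<Rightarrow> real^'d \<Rightarrow> nat \<Rightarrow> real"
where
  "path_stage_cost A B Q R K s x t =
     (let y = trajectory A B K s x t in stage_cost Q R (s t) y (feedback K (s t) y))"

text \<open>
  Costs are extended nonnegative reals, so that the cost of a policy may be infinite; for positive
  definite weights the stage costs are nonnegative and the embedding into \<^typ>\<open>ennreal\<close> is faithful.
\<close>

definition policy_cost ::
  "'w measure \<Rightarrow> (nat \<Rightarrow> 'w \<Rightarrow> 's) \<Rightarrow> ('w \<Rightarrow> real^'d) \<Rightarrow>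
   ('s \<Rightarrow> real^'d^'d) \<Rightarrow> ('s \<Rightarrow> real^'k^'d) \<Rightarrow> ('s \<Rightarrow> real^'d^'d) \<Rightarrow> ('s \<Rightarrow> real^'k^'k) \<Rightarrow>
   ('s \<Rightarrow> real^'d^'k) \<Rightarrow> ennreal"
where
  "policy_cost M \<omega> x0 A B Q R K =
     (\<integral>\<^sup>+w. (\<Sum>t. ennreal (path_stage_cost A B Q R K (\<lambda>r. \<omega> r w) (x0 w) t)) \<partial>M)"

definition truncated_cost ::
  "'w measure \<Rightarrow> (nat \<Rightarrow> 'w \<Rightarrow> 's) \<Rightarrow> ('w \<Rightarrow> real^'d) \<Rightarrow>
   ('s \<Rightarrow> real^'d^'d) \<Rightarrow> ('s \<Rightarrow> real^'k^'d) \<Rightarrow> ('s \<Rightarrow> real^'d^'d) \<Rightarrow> ('s \<Rightarrow> real^'k^'k) \<Rightarrow>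
   nat \<Rightarrow> ('s \<Rightarrow> real^'d^'k) \<Rightarrow> ennreal"
where
  "truncated_cost M \<omega> x0 A B Q R l K =
     (\<integral>\<^sup>+w. (\<Sum>t<l. ennreal (path_stage_cost A B Q R K (\<lambda>r. \<omega> r w) (x0 w) t)) \<partial>M)"

definition Lambda_min :: "('s::finite \<Rightarrow> real^'d^'d) \<Rightarrow> real" where
  "Lambda_min Q = (MIN i. sigma_min (Q i))"

definition mu_const :: "('s::finite \<Rightarrow> real) \<Rightarrow> (real^'d) measure \<Rightarrow> real" where
  "mu_const \<pi> D = (MIN i. \<pi> i) * sigma_min (second_moment D)"

end

theory Submission
  imports Defs
begin

text \<open>
  The cost accumulated over \<open>n\<close> steps from mode \<open>i\<close> and state \<open>x\<close> is a positive semidefinite quadratic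
  form in \<open>x\<close>. Its average over the initial state and mode is at most \<open>C(K)\<close>, so comparison with the
  second moment of \<open>x\<^sub>0\<close> bounds it by \<open>C(K) \<parallel>x\<parallel>\<^sup>2 / \<mu>\<close>. By the Markov property, the expected cost
  from time \<open>t\<close> on is therefore at most \<open>\<kappa> e\<^sub>t\<close>, where \<open>e\<^sub>t\<close> is the expected stage cost at time \<open>t\<close>
  and \<open>\<kappa> = C(K) / (\<mu> \<Lambda>)\<close> with \<open>\<Lambda> = \<Lambda>\<^sub>m\<^sub>i\<^sub>n(Q)\<close>. Tails decrease in \<open>t\<close>, so summing over \<open>t < l\<close> gives
  \<open>l (C(K) - C\<^sup>l(K)) \<le> \<kappa> C(K)\<close>. This is stronger than the claim, because
  \<open>\<Lambda>\<close> is at most the largest singular value of each \<open>Q\<^sub>i\<close>.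
\<close>

section \<open>Positive semidefinite forms and least eigenvectors\<close>

text \<open>Semidefinite rather than definite, because the value matrix at horizon 0 is 0. Including
  symmetry makes Cauchy-Schwarz available for the form.\<close>

definition psd :: "real^'n^'n \<Rightarrow> bool" where
  "psd P \<longleftrightarrow> transpose P = P \<and> (\<forall>x. 0 \<le> x \<bullet> (P *v x))"

lemma symmetric_inner:
  fixes P :: "real^'n^'n"
  assumes "transpose P = P"
  shows "x \<bullet> (P *v y) = y \<bullet> (P *v x)"
  by (metis assms dot_lmul_matrix inner_commute transpose_matrix_vector)

lemma psd_Cauchy_Schwarz:
  fixes P :: "real^'n^'n"
  assumes "psd P"
  shows "(x \<bullet> (P *v y))\<^sup>2 \<le> (x \<bullet> (P *v x)) * (y \<bullet> (P *v y))"
proof -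
  let ?a = "x \<bullet> (P *v x)" and ?b = "x \<bullet> (P *v y)" and ?c = "y \<bullet> (P *v y)"
  have sym: "y \<bullet> (P *v x) = ?b"
    using assms symmetric_inner unfolding psd_def by metis
  have expand: "0 \<le> s\<^sup>2 * ?a + 2 * s * r * ?b + r\<^sup>2 * ?c" for s r
  proof -
    have "0 \<le> (s *\<^sub>R x + r *\<^sub>R y) \<bullet> (P *v (s *\<^sub>R x + r *\<^sub>R y))"
      using assms unfolding psd_def by blast
    also have "\<dots> = s\<^sup>2 * ?a + 2 * s * r * ?b + r\<^sup>2 * ?c"
      by (simp add: matrix_vector_right_distrib matrix_vector_mult_scaleR inner_add_left
          inner_add_right sym power2_eq_square algebra_simps)
    finally show ?thesis .
  qed
  have nonneg: "0 \<le> ?a" "0 \<le> ?c"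
    using assms unfolding psd_def by auto
  show ?thesis
  proof (cases "?c = 0")
    case False
    then have "0 < ?c" using nonneg by simp
    \<comment> \<open>The minimizer of the quadratic polynomial in \<open>r/s\<close> is
      \<open>- ?b / ?c\<close>; scaling by \<open>?c\<close> avoids the division.\<close>
    have "0 \<le> ?c * (?a * ?c - ?b\<^sup>2)"
      using expand[of ?c "- ?b"] by (simp add: power2_eq_square algebra_simps)
    then show ?thesis
      using \<open>0 < ?c\<close> by (simp add: zero_le_mult_iff)
  next
    case True
    \<comment> \<open>With \<open>?c = 0\<close> the polynomial is affine in \<open>r\<close>, so a
      nonzero slope would let it go negative; the chosen \<open>r\<close> makes it equal to
      -1.\<close>
    have "?b = 0"
    proof (rule ccontr)
      assume "?b \<noteq> 0"
      moreover have "0 \<le> ?a + 2 * (- ((?a + 1) / (2 * ?b))) * ?b"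
        using expand[of 1 "- ((?a + 1) / (2 * ?b))"] True by simp
      ultimately show False by simp
    qed
    then show ?thesis by (simp add: True)
  qed
qed

text \<open>
  At a minimizer \<open>v\<close> of the Rayleigh quotient with minimum \<open>e\<close>, the form of \<open>P - e I\<close> is
  positive semidefinite and vanishes, so Cauchy--Schwarz for this form gives \<open>(P - e I) v = 0\<close>.
\<close>

lemma symmetric_min_eigenvector:
  fixes P :: "real^'n^'n"
  assumes "transpose P = P"
  obtains v e where "norm v = 1" "P *v v = e *\<^sub>R v" "\<And>x. e * (norm x)\<^sup>2 \<le> x \<bullet> (P *v x)"
proof -
  have "\<exists>v\<in>sphere 0 1. \<forall>y\<in>sphere 0 (1::real). v \<bullet> (P *v v) \<le> (y :: real^'n) \<bullet> (P *v y)"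
  proof (rule continuous_attains_inf)
    show "sphere (0::real^'n) 1 \<noteq> {}"
      by simp
  qed (auto intro!: continuous_on_inner continuous_on_id matrix_vector_mult_linear_continuous_on)
  then obtain v where v: "norm v = 1" "\<And>y. norm y = 1 \<Longrightarrow> v \<bullet> (P *v v) \<le> y \<bullet> (P *v y)"
    by auto
  define e where "e = v \<bullet> (P *v v)"
  have bound: "e * (norm x)\<^sup>2 \<le> x \<bullet> (P *v x)" for x
  proof (cases "x = 0")
    case False
    have "e \<le> (x /\<^sub>R norm x) \<bullet> (P *v (x /\<^sub>R norm x))"
      unfolding e_def by (rule v(2)) (use False in simp)
    then show ?thesis
      using False by (simp add: matrix_vector_mult_scaleR field_simps power2_eq_square)
  qed simp
  define S where "S = P - e *\<^sub>R mat 1"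
  have S: "S *v x = P *v x - e *\<^sub>R x" for x
    by (simp add: S_def matrix_vector_mult_diff_rdistrib scaleR_matrix_vector_assoc[symmetric])
  have "transpose S = S"
    using assms by (simp add: S_def transpose_def vec_eq_iff mat_def)
  moreover have "0 \<le> x \<bullet> (S *v x)" for x
    using bound[of x] by (simp add: S inner_diff_right power2_norm_eq_inner)
  ultimately have "psd S" by (simp add: psd_def)
  have "v \<bullet> (S *v v) = 0"
    using v(1) by (simp add: S inner_diff_right e_def flip: power2_norm_eq_inner)
  then have "((S *v v) \<bullet> (S *v v))\<^sup>2 \<le> 0"
    using psd_Cauchy_Schwarz[OF \<open>psd S\<close>, of "S *v v" v] by simp
  then have "S *v v = 0" by simp
  with that[OF v(1) _ bound] show ?thesis by (simp add: S)
qed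

section \<open>Singular values\<close>

lemma transpose_Gram: "transpose (transpose A ** A) = transpose A ** (A :: real^'n^'m)"
  by (simp add: matrix_transpose_mul)

text \<open>Choosing one eigenvector per eigenvalue gives an orthogonal family, which is finite in
  finite dimension. Finiteness and nonemptiness of the spectrum are what give \<open>Max\<close> and
  \<open>Min\<close> of the singular values their meaning.\<close>

lemma eigenvalues_symmetric_finite:
  fixes P :: "real^'n^'n"
  assumes "transpose P = P"
  shows "finite {e. \<exists>v. v \<noteq> 0 \<and> P *v v = e *\<^sub>R v}"
proof -
  define E where "E = {e. \<exists>v. v \<noteq> 0 \<and> P *v v = e *\<^sub>R v}"
  define f where "f e = (SOME v. v \<noteq> 0 \<and> P *v v = e *\<^sub>R v)" for e
  have f: "f e \<noteq> 0 \<and> P *v f e = e *\<^sub>R f e" if "e \<in> E" for e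
    unfolding f_def by (rule someI_ex) (use that in \<open>simp add: E_def\<close>)
  have inj: "inj_on f E"
  proof (rule inj_onI)
    fix a b assume "a \<in> E" "b \<in> E" "f a = f b"
    then have "a *\<^sub>R f a = b *\<^sub>R f a" using f by metis
    then show "a = b" using f[OF \<open>a \<in> E\<close>] by simp
  qed
  have "orthogonal (f a) (f b)" if "a \<in> E" "b \<in> E" "f a \<noteq> f b" for a b
  proof -
    have "b * (f a \<bullet> f b) = f a \<bullet> (P *v f b)"
      by (simp add: f \<open>b \<in> E\<close>)
    also have "\<dots> = f b \<bullet> (P *v f a)"
      by (rule symmetric_inner[OF assms])
    also have "\<dots> = a * (f a \<bullet> f b)"
      by (simp add: f \<open>a \<in> E\<close> inner_commute)
    finally have "b * (f a \<bullet> f b) = a * (f a \<bullet> f b)" .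
    moreover have "a \<noteq> b" using \<open>f a \<noteq> f b\<close> by auto
    ultimately show ?thesis
      by (simp add: orthogonal_def)
  qed
  then have "pairwise orthogonal (f ` E)"
    unfolding pairwise_def by blast
  then have "finite (f ` E)"
    by (rule pairwise_orthogonal_imp_finite)
  then have "finite E"
    using inj by (rule finite_imageD)
  then show ?thesis by (simp add: E_def)
qed

lemma finite_singular_values: "finite (singular_values (A :: real^'n^'m))"
proof -
  have "singular_values A = sqrt ` {e. \<exists>v. v \<noteq> 0 \<and> (transpose A ** A) *v v = e *\<^sub>R v}"
    by (simp only: singular_values_def setcompr_eq_image)
  also have "finite \<dots>"
    by (rule finite_imageI) (rule eigenvalues_symmetric_finite[OF transpose_Gram])
  finally show ?thesis .
qed

lemma singular_values_nonempty: "singular_values (A :: real^'n^'m) \<noteq> {}"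
proof -
  obtain v e where "norm v = 1" "(transpose A ** A) *v v = e *\<^sub>R v"
    by (rule symmetric_min_eigenvector[OF transpose_Gram[of A]])
  moreover from this have "v \<noteq> 0" by auto
  ultimately show ?thesis
    unfolding singular_values_def by blast
qed

lemma singular_value_norm:
  fixes A :: "real^'n^'m"
  assumes "s \<in> singular_values A"
  obtains v where "v \<noteq> 0" "norm (A *v v) = s * norm v"
proof -
  obtain e v where e: "s = sqrt e" "v \<noteq> 0" "(transpose A ** A) *v v = e *\<^sub>R v"
    using assms unfolding singular_values_def by blast
  have "(norm (A *v v))\<^sup>2 = e * (norm v)\<^sup>2"
  proof -
    have "(norm (A *v v))\<^sup>2 = v \<bullet> ((transpose A ** A) *v v)"
      by (metis dot_lmul_matrix inner_commute matrix_vector_mul_assoc power2_norm_eq_inner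
          transpose_matrix_vector transpose_transpose)
    then show ?thesis by (simp add: e(3) power2_norm_eq_inner)
  qed
  \<comment> \<open>\<open>sqrt\<close> is multiplicative on all reals, so the root can be taken
    before the sign of \<open>e\<close> is known; \<open>singular_value_nonneg\<close> then reads
    the sign off this identity.\<close>
  then have "norm (A *v v) = s * norm v"
    by (metis e(1) real_sqrt_abs real_sqrt_mult abs_norm_cancel)
  then show ?thesis using that e(2) by blast
qed

lemma singular_value_nonneg:
  assumes "s \<in> singular_values (A :: real^'n^'m)"
  shows "0 \<le> s"
proof -
  obtain v where "v \<noteq> 0" "norm (A *v v) = s * norm v"
    using singular_value_norm[OF assms] .
  then show ?thesis
    using norm_ge_zero[of "A *v v"] by (simp add: zero_le_mult_iff)
qed

lemma sigma_max_nonneg: "0 \<le> sigma_max (A :: real^'n^'m)"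
  unfolding sigma_max_def
  by (rule singular_value_nonneg[of _ A]) (intro Max_in finite_singular_values singular_values_nonempty)

lemma sigma_min_le_sigma_max: "sigma_min A \<le> sigma_max A"
  unfolding sigma_min_def sigma_max_def
  by (intro Min_le Max_in finite_singular_values singular_values_nonempty)

lemma positive_definite_imp_psd:
  assumes "positive_definite P"
  shows "psd P"
proof -
  have "0 \<le> x \<bullet> (P *v x)" for x
    using assms by (cases "x = 0") (auto simp: positive_definite_def less_imp_le)
  then show ?thesis
    using assms by (simp add: psd_def positive_definite_def)
qed

text \<open>A singular value 0 would produce a nonzero vector in the kernel of \<open>P\<close>,
  where the form vanishes.\<close>

lemma sigma_min_pos:
  assumes "positive_definite P"
  shows "0 < sigma_min P"
proof -
  have "sigma_min P \<in> singular_values P"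
    unfolding sigma_min_def by (intro Min_in finite_singular_values singular_values_nonempty)
  then obtain v where v: "v \<noteq> 0" "norm (P *v v) = sigma_min P * norm v" and "0 \<le> sigma_min P"
    using singular_value_norm[of "sigma_min P" P] singular_value_nonneg[of "sigma_min P" P] by auto
  have "P *v v \<noteq> 0"
    using assms v(1) unfolding positive_definite_def by force
  then have "sigma_min P \<noteq> 0" using v by auto
  with \<open>0 \<le> sigma_min P\<close> show ?thesis by simp
qed

text \<open>The least eigenvalue \<open>e\<close> bounds the form from below. Being nonnegative, it
  is the root of the eigenvalue \<open>e\<^sup>2\<close> of the Gram matrix, hence a singular value
  and at least \<open>sigma_min P\<close>.\<close>

lemma sigma_min_le_quadratic_form:
  assumes "psd P"
  shows "sigma_min P * (norm x)\<^sup>2 \<le> x \<bullet> (P *v x)"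
proof -
  have sym: "transpose P = P" using assms by (simp add: psd_def)
  obtain v e where v: "norm v = 1" "P *v v = e *\<^sub>R v"
    and e: "\<And>x. e * (norm x)\<^sup>2 \<le> x \<bullet> (P *v x)"
    by (rule symmetric_min_eigenvector[OF sym]) (rule that, assumption+)
  have "0 \<le> v \<bullet> (P *v v)" using assms by (simp add: psd_def)
  then have "0 \<le> e" using v by (simp flip: power2_norm_eq_inner)
  have "(transpose P ** P) *v v = e\<^sup>2 *\<^sub>R v"
    by (simp add: sym v matrix_vector_mult_scaleR power2_eq_square flip: matrix_vector_mul_assoc)
  moreover have "v \<noteq> 0" using v by auto
  moreover have "e = sqrt (e\<^sup>2)" using \<open>0 \<le> e\<close> by simp
  ultimately have "e \<in> singular_values P"
    unfolding singular_values_def by blast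
  then have "sigma_min P \<le> e"
    unfolding sigma_min_def using finite_singular_values by (rule Min_le[rotated])
  then show ?thesis
    using e[of x] mult_right_mono[of "sigma_min P" e "(norm x)\<^sup>2"] by simp
qed

section \<open>Operations preserving semidefiniteness, as they occur in the value recursion\<close>

lemma psd_add: "psd P \<Longrightarrow> psd S \<Longrightarrow> psd (P + S)"
  by (auto simp: psd_def transpose_def vec_eq_iff matrix_vector_mult_add_rdistrib inner_add_right)

lemma psd_scaleR: "psd P \<Longrightarrow> 0 \<le> c \<Longrightarrow> psd (c *\<^sub>R P)"
  by (auto simp: psd_def transpose_def vec_eq_iff scaleR_matrix_vector_assoc[symmetric])

lemma psd_0: "psd 0"
  by (simp add: psd_def transpose_def vec_eq_iff)

lemma sum_matrix_vector_mult:
  fixes P :: "'i \<Rightarrow> real^'n^'m"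
  shows "(\<Sum>i\<in>I. P i) *v x = (\<Sum>i\<in>I. P i *v x)"
  by (induction I rule: infinite_finite_induct) (simp_all add: matrix_vector_mult_add_rdistrib)

lemma psd_sum: "finite I \<Longrightarrow> (\<And>i. i \<in> I \<Longrightarrow> psd (P i)) \<Longrightarrow> psd (\<Sum>i\<in>I. P i)"
  by (induction rule: finite_induct) (auto intro: psd_add psd_0)

lemma inner_congruence:
  "x \<bullet> ((transpose F ** P ** F) *v x) = (F *v x) \<bullet> (P *v (F *v (x :: real^'n)))"
  by (metis dot_lmul_matrix inner_commute matrix_vector_mul_assoc transpose_matrix_vector)

lemma psd_congruence:
  fixes F :: "real^'n^'m"
  assumes "psd P"
  shows "psd (transpose F ** P ** F)"
  using assms by (auto simp: psd_def inner_congruence matrix_transpose_mul matrix_mul_assoc)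

section \<open>Quadratic forms and the second moment\<close>

lemma quadratic_form_outer:
  fixes x w :: "real^'n"
  shows "w \<bullet> ((columnvector x ** (rowvector x :: real^'n^1)) *v w) = (w \<bullet> x)\<^sup>2"
proof -
  have "(columnvector x ** (rowvector x :: real^'n^1)) *v w = (x \<bullet> w) *\<^sub>R x"
    by (simp add: vec_eq_iff matrix_vector_mult_def matrix_matrix_mult_def columnvector_def
        rowvector_def inner_vec_def sum_distrib_left sum_distrib_right mult_ac)
  then show ?thesis by (simp add: inner_commute power2_eq_square)
qed

text \<open>Linearity in the matrix, for fixed \<open>w\<close>, lets the form pass through the
  matrix-valued integral in \<open>second_moment\<close>.\<close>

lemma bounded_linear_quadratic_form: "bounded_linear (\<lambda>S :: real^'n^'n. w \<bullet> (S *v w))"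
  unfolding linear_conv_bounded_linear[symmetric]
  by (rule linearI)
    (simp_all add: matrix_vector_mult_add_rdistrib inner_add_right scaleR_matrix_vector_assoc[symmetric])

lemma nn_integral_square_inner:
  fixes D :: "(real^'n) measure"
  assumes "integrable D (\<lambda>x. columnvector x ** (rowvector x :: real^'n^1))"
  shows "(\<integral>\<^sup>+x. ennreal ((w \<bullet> x)\<^sup>2) \<partial>D) = ennreal (w \<bullet> (second_moment D *v w))"
proof -
  have "integrable D (\<lambda>x. (w \<bullet> x)\<^sup>2)"
    using integrable_bounded_linear[OF bounded_linear_quadratic_form assms, of w]
    by (simp only: quadratic_form_outer)
  moreover have "(\<integral>x. (w \<bullet> x)\<^sup>2 \<partial>D) = w \<bullet> (second_moment D *v w)"
    using integral_bounded_linear[OF bounded_linear_quadratic_form assms, of w]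
    by (simp only: quadratic_form_outer second_moment_def)
  ultimately show ?thesis
    by (simp add: nn_integral_eq_integral)
qed

text \<open>
  Cauchy--Schwarz for \<open>P\<close> bounds the square of \<open>Pv \<bullet> x\<close> by \<open>(v \<bullet> Pv) (x \<bullet> Px)\<close>. Taking expectations
  over \<open>x\<close> brings in the second moment and avoids traces and diagonalization of \<open>P\<close>.
\<close>

lemma quadratic_form_le_expectation:
  fixes D :: "(real^'n) measure"
  assumes sets: "sets D = sets borel"
    and int: "integrable D (\<lambda>x. columnvector x ** (rowvector x :: real^'n^1))"
    and "psd (second_moment D)" and P: "psd P"
    and r: "(\<integral>\<^sup>+x. ennreal (x \<bullet> (P *v x)) \<partial>D) \<le> ennreal r" "0 \<le> r"
  shows "sigma_min (second_moment D) * (v \<bullet> (P *v v)) \<le> (norm v)\<^sup>2 * r"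
proof (cases "sigma_min (second_moment D) * (v \<bullet> (P *v v)) \<le> 0")
  case True
  then show ?thesis using r(2) by (meson order_trans mult_nonneg_nonneg zero_le_power2)
next
  case False
  define a where "a = v \<bullet> (P *v v)"
  define \<sigma> where "\<sigma> = sigma_min (second_moment D)"
  have "0 \<le> a" using P by (simp add: a_def psd_def)
  with False have pos: "0 < a" "0 < \<sigma>"
    by (auto simp: a_def \<sigma>_def not_le zero_less_mult_iff)
  have [measurable]: "(\<lambda>x. ennreal (x \<bullet> (P *v x))) \<in> borel_measurable D"
    unfolding measurable_cong_sets[OF sets refl]
    by (intro measurable_compose[OF _ measurable_ennreal] borel_measurable_continuous_onI
        continuous_on_inner continuous_on_id matrix_vector_mult_linear_continuous_on)
  have "((P *v v) \<bullet> x)\<^sup>2 \<le> a * (x \<bullet> (P *v x))" for x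
    using psd_Cauchy_Schwarz[OF P, of x v] by (simp add: a_def inner_commute mult.commute)
  then have "(\<integral>\<^sup>+x. ennreal (((P *v v) \<bullet> x)\<^sup>2) \<partial>D) \<le> (\<integral>\<^sup>+x. ennreal a * ennreal (x \<bullet> (P *v x)) \<partial>D)"
    using pos(1) by (intro nn_integral_mono) (simp add: ennreal_leI flip: ennreal_mult')
  also have "\<dots> = ennreal a * (\<integral>\<^sup>+x. ennreal (x \<bullet> (P *v x)) \<partial>D)"
    by (rule nn_integral_cmult) measurable
  also have "\<dots> \<le> ennreal (a * r)"
    using r pos(1) by (simp add: ennreal_mult mult_left_mono)
  finally have "(P *v v) \<bullet> (second_moment D *v (P *v v)) \<le> a * r"
    using pos(1) r(2) by (simp add: nn_integral_square_inner[OF int] ennreal_le_iff)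
  with sigma_min_le_quadratic_form[OF assms(3), of "P *v v"]
  have *: "\<sigma> * (norm (P *v v))\<^sup>2 \<le> a * r" by (simp add: \<sigma>_def)
  \<comment> \<open>The Euclidean Cauchy-Schwarz inequality trades the norm of \<open>Pv\<close> for
    \<open>a\<close>; one of the resulting factors \<open>a\<close> then cancels.\<close>
  have "a\<^sup>2 \<le> (norm v)\<^sup>2 * (norm (P *v v))\<^sup>2"
    using Cauchy_Schwarz_ineq[of v "P *v v"] by (simp add: a_def power2_norm_eq_inner)
  then have "\<sigma> * a\<^sup>2 \<le> \<sigma> * ((norm v)\<^sup>2 * (norm (P *v v))\<^sup>2)"
    using pos(2) by simp
  also have "\<dots> = (norm v)\<^sup>2 * (\<sigma> * (norm (P *v v))\<^sup>2)" by simp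
  also have "\<dots> \<le> (norm v)\<^sup>2 * (a * r)" by (intro mult_left_mono * zero_le_power2)
  finally have "a * (\<sigma> * a) \<le> a * ((norm v)\<^sup>2 * r)"
    by (simp add: power2_eq_square algebra_simps)
  then show ?thesis using pos(1) by (simp add: a_def \<sigma>_def)
qed

section \<open>Closed-loop trajectories and their measurability\<close>

lemma trajectory_Suc_closed_loop:
  "trajectory A B K s x (Suc t) = (A (s t) - B (s t) ** K (s t)) *v trajectory A B K s x t"
  by (simp add: feedback_def matrix_vector_mult_diff_rdistrib matrix_vector_mul_assoc[symmetric]
      linear_neg[OF matrix_vector_mul_linear])

lemma trajectory_cong:
  "(\<And>r. r < t \<Longrightarrow> s r = s' r) \<Longrightarrow> trajectory A B K s x t = trajectory A B K s' x t"
  by (induction t) auto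

lemma borel_measurable_matrix_vector_mult [measurable]:
  "(*v) (A :: real^'n^'m) \<in> borel_measurable borel"
  by (intro borel_measurable_continuous_onI matrix_vector_mult_linear_continuous_on)

lemma borel_measurable_trajectory [measurable]:
  fixes x :: "'w \<Rightarrow> real^'d" and A :: "'s::finite \<Rightarrow> real^'d^'d" and B :: "'s \<Rightarrow> real^'k^'d"
  assumes [measurable]: "x \<in> borel_measurable M" "\<And>t. s t \<in> measurable M (count_space UNIV)"
  shows "(\<lambda>w. trajectory A B K (\<lambda>r. s r w) (x w) t) \<in> borel_measurable M"
proof (induction t)
  case (Suc t)
  note [measurable] = Suc.IH
  have "(\<lambda>w. (A i - B i ** K i) *v trajectory A B K (\<lambda>r. s r w) (x w) t) \<in> borel_measurable M" for i
    by measurable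
  then show ?case
    unfolding trajectory_Suc_closed_loop by (rule measurable_compose_countable) (rule assms)
qed simp

lemma Lambda_min_le: "Lambda_min Q \<le> sigma_min (Q i)"
  by (simp add: Lambda_min_def)

lemma Lambda_min_pos: "(\<And>i. positive_definite (Q i)) \<Longrightarrow> 0 < Lambda_min Q"
  by (simp add: Lambda_min_def sigma_min_pos)

text \<open>The tail at \<open>l\<close> is below each of the \<open>l\<close> earlier tails, so
  \<open>l\<close> copies of it are bounded by their sum.\<close>

lemma tail_le_of_proportional_tails:
  fixes e :: "nat \<Rightarrow> real"
  assumes "summable e" "\<And>t. 0 \<le> e t" "0 \<le> \<kappa>" and tail: "\<And>t. (\<Sum>r. e (r + t)) \<le> \<kappa> * e t"
  shows "real l * (\<Sum>r. e (r + l)) \<le> \<kappa> * suminf e"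
proof -
  have mono: "(\<Sum>r. e (r + l)) \<le> (\<Sum>r. e (r + t))" if "t < l" for t
  proof -
    have "sum e {..<t} \<le> sum e {..<l}"
      using that assms(2) by (intro sum_mono2) auto
    then show ?thesis
      using suminf_split_initial_segment[OF assms(1), of t]
        suminf_split_initial_segment[OF assms(1), of l] by linarith
  qed
  have "real l * (\<Sum>r. e (r + l)) = (\<Sum>t<l. \<Sum>r. e (r + l))" by simp
  also have "\<dots> \<le> (\<Sum>t<l. \<kappa> * e t)"
    by (intro sum_mono) (use mono tail order_trans in blast)
  also have "\<dots> = \<kappa> * (\<Sum>t<l. e t)" by (simp add: sum_distrib_left)
  also have "\<dots> \<le> \<kappa> * suminf e"
    by (intro mult_left_mono sum_le_suminf assms) auto
  finally show ?thesis .
qed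

section \<open>Histories of the chain and the Markov property\<close>

text \<open>The weights are semidefinite here; strict positivity enters later through
  \<open>0 < m\<close> and \<open>0 < Lambda_min Q\<close>.\<close>

locale markov_jump_system =
  fixes M :: "'w measure" and \<omega> :: "nat \<Rightarrow> 'w \<Rightarrow> 's::finite"
    and \<pi> :: "'s \<Rightarrow> real" and p :: "'s \<Rightarrow> 's \<Rightarrow> real" and x0 :: "'w \<Rightarrow> real^'d"
    and A :: "'s \<Rightarrow> real^'d^'d" and B :: "'s \<Rightarrow> real^'k^'d"
    and Q :: "'s \<Rightarrow> real^'d^'d" and R :: "'s \<Rightarrow> real^'k^'k" and K :: "'s \<Rightarrow> real^'d^'k"
  assumes chain: "markov_chain M \<omega> \<pi> p"
    and indep: "independent_rvs M borel x0 (Pi\<^sub>M UNIV (\<lambda>_. count_space UNIV)) (\<lambda>w t. \<omega> t w)"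
    and Q: "\<And>i. psd (Q i)" and R: "\<And>i. psd (R i)"
begin

sublocale prob_space M
  using chain by (simp add: markov_chain_def)

lemma mode_measurable [measurable]: "\<omega> t \<in> measurable M (count_space UNIV)"
  using chain by (simp add: markov_chain_def)

lemma x0_measurable [measurable]: "x0 \<in> borel_measurable M"
  using indep by (simp add: independent_rvs_def)

lemma p_nonneg: "0 \<le> p i j"
  using chain by (simp add: markov_chain_def)

definition cylinder :: "(nat \<Rightarrow> 's) \<Rightarrow> nat \<Rightarrow> 'w set" where
  "cylinder h t = {w \<in> space M. \<forall>r\<le>t. \<omega> r w = h r}"

lemma cylinder_measurable [measurable]: "cylinder h t \<in> sets M"
  unfolding cylinder_def by measurable

lemma emeasure_cylinder_0: "emeasure M (cylinder h 0) = ennreal (\<pi> (h 0))"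
  using chain by (simp add: cylinder_def markov_chain_def emeasure_eq_measure)

lemma emeasure_cylinder_Suc:
  "emeasure M (cylinder (h(Suc t := j)) (Suc t)) = emeasure M (cylinder h t) * ennreal (p (h t) j)"
proof -
  have sub: "cylinder (h(Suc t := j)) (Suc t) = {w \<in> space M. \<omega> (Suc t) w = j \<and> (\<forall>r\<le>t. \<omega> r w = h r)}"
    unfolding cylinder_def by (auto simp: le_Suc_eq)
  have "prob (cylinder (h(Suc t := j)) (Suc t)) = prob (cylinder h t) * p (h t) j"
  proof (cases "0 < prob (cylinder h t)")
    case True
    then have "\<P>(w in M. \<omega> (Suc t) w = j \<bar> \<forall>r\<le>t. \<omega> r w = h r) = p (h t) j"
      using chain unfolding markov_chain_def cylinder_def by blast
    then show ?thesis
      using True unfolding sub by (simp add: cond_prob_def cylinder_def field_simps)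
  next
    \<comment> \<open>A null history has conditional probability 0 by convention, but its extensions
      are null too, so the product formula survives.\<close>
    case False
    then have "prob (cylinder h t) = 0"
      by (simp add: zero_less_measure_iff)
    moreover have "prob (cylinder (h(Suc t := j)) (Suc t)) \<le> prob (cylinder h t)"
      by (rule finite_measure_mono) (auto simp: sub, auto simp: cylinder_def)
    ultimately show ?thesis by (simp add: measure_le_0_iff)
  qed
  then show ?thesis
    by (simp add: emeasure_eq_measure ennreal_mult p_nonneg)
qed

text \<open>Independence of \<sigma>-algebras is a statement about events. It extends to functions
  of \<open>x0\<close> by comparing measures: restricting \<open>M\<close> to a cylinder only
  rescales the law of \<open>x0\<close>.\<close>

lemma nn_integral_indicator_cylinder:
  assumes [measurable]: "f \<in> borel_measurable borel"
  shows "(\<integral>\<^sup>+w. f (x0 w) * indicator (cylinder h t) w \<partial>M) =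
    emeasure M (cylinder h t) * (\<integral>\<^sup>+w. f (x0 w) \<partial>M)"
proof -
  let ?E = "cylinder h t" and ?T = "Pi\<^sub>M UNIV (\<lambda>_::nat. count_space (UNIV :: 's set))"
  have "{s \<in> space ?T. \<forall>r\<le>t. s r = h r} \<in> sets ?T"
    by measurable
  then have "(\<lambda>w t. \<omega> t w) -` {s \<in> space ?T. \<forall>r\<le>t. s r = h r} \<inter> space M
      \<in> sets (vimage_algebra (space M) (\<lambda>w t. \<omega> t w) ?T)"
    by (rule in_vimage_algebra)
  also have "(\<lambda>w t. \<omega> t w) -` {s \<in> space ?T. \<forall>r\<le>t. s r = h r} \<inter> space M = ?E"
    by (auto simp: cylinder_def space_PiM)
  finally have E: "?E \<in> sets (vimage_algebra (space M) (\<lambda>w t. \<omega> t w) ?T)" .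
  have "distr (density M (indicator ?E)) borel x0 = scale_measure (emeasure M ?E) (distr M borel x0)"
  proof (rule measure_eqI)
    fix S assume "S \<in> sets (distr (density M (indicator ?E)) borel x0)"
    then have [measurable]: "S \<in> sets borel" by simp
    have "prob ((x0 -` S \<inter> space M) \<inter> ?E) = prob (x0 -` S \<inter> space M) * prob ?E"
      using indep E unfolding independent_rvs_def
      by (intro indep_setD[where A = "sets (vimage_algebra (space M) x0 borel)"])
        (auto intro: in_vimage_algebra)
    then have "emeasure M ((x0 -` S \<inter> space M) \<inter> ?E) = emeasure M ?E * emeasure M (x0 -` S \<inter> space M)"
      by (simp add: emeasure_eq_measure ennreal_mult mult.commute)
    moreover have "emeasure (distr (density M (indicator ?E)) borel x0) S =
        emeasure M ((x0 -` S \<inter> space M) \<inter> ?E)"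
      by (simp add: emeasure_distr emeasure_density Int_commute flip: indicator_inter_arith)
    ultimately show "emeasure (distr (density M (indicator ?E)) borel x0) S =
        emeasure (scale_measure (emeasure M ?E) (distr M borel x0)) S"
      by (simp add: emeasure_distr)
  qed simp
  then have "(\<integral>\<^sup>+x. f x \<partial>distr (density M (indicator ?E)) borel x0) =
      emeasure M ?E * (\<integral>\<^sup>+x. f x \<partial>distr M borel x0)"
    by (simp add: nn_integral_scale_measure)
  then show ?thesis
    by (simp add: nn_integral_distr nn_integral_density mult.commute)
qed

text \<open>The cylinders over extensional histories partition the space into finitely many pieces,
  so exactly one summand survives at \<open>w\<close>.\<close>

lemma sum_histories:
  fixes c :: ennreal
  assumes "w \<in> space M" and "\<And>h. (\<And>r. r \<le> t \<Longrightarrow> h r = \<omega> r w) \<Longrightarrow> \<phi> h = c"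
  shows "(\<Sum>h\<in>PiE {..t} (\<lambda>_. UNIV). \<phi> h * indicator (cylinder h t) w) = c"
proof -
  let ?H = "PiE {..t} (\<lambda>_. UNIV :: 's set)" and ?h = "restrict (\<lambda>r. \<omega> r w) {..t}"
  have "\<phi> h * indicator (cylinder h t) w = (if h = ?h then c else 0)" if "h \<in> ?H" for h
  proof (cases "h = ?h")
    case True
    then show ?thesis using assms by (simp add: cylinder_def)
  next
    case False
    have "w \<notin> cylinder h t"
    proof
      assume "w \<in> cylinder h t"
      then have "h = ?h"
        by (intro PiE_ext[OF that]) (auto simp: cylinder_def)
      with False show False ..
    qed
    with False show ?thesis by simp
  qed
  then have "(\<Sum>h\<in>?H. \<phi> h * indicator (cylinder h t) w) = (\<Sum>h\<in>?H. if h = ?h then c else 0)"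
    by (intro sum.cong refl)
  also have "\<dots> = c"
    by (subst sum.delta) (auto intro: finite_PiE)
  finally show ?thesis .
qed

text \<open>The chain is only specified on cylinders, so the integral is split over histories.
  \<open>g\<close> may depend on the whole past and on \<open>x0\<close>, since the state at a later
  time does.\<close>

lemma markov_property:
  fixes g :: "(nat \<Rightarrow> 's) \<Rightarrow> 's \<Rightarrow> real^'d \<Rightarrow> ennreal"
  assumes [measurable]: "\<And>h j. g h j \<in> borel_measurable borel"
    and cong: "\<And>h h'. (\<And>r. r \<le> t \<Longrightarrow> h r = h' r) \<Longrightarrow> g h = g h'"
  shows "(\<integral>\<^sup>+w. g (\<lambda>r. \<omega> r w) (\<omega> (Suc t) w) (x0 w) \<partial>M) =
    (\<integral>\<^sup>+w. (\<Sum>j\<in>UNIV. ennreal (p (\<omega> t w) j) * g (\<lambda>r. \<omega> r w) j (x0 w)) \<partial>M)"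
proof -
  let ?H = "PiE {..t} (\<lambda>_. UNIV :: 's set)"
  \<comment> \<open>\<open>F\<close> is left arbitrary so that the same decomposition serves the
    integrand before and after averaging over the next mode.\<close>
  have histories: "(\<Sum>h\<in>?H. F (g h) (h t) * indicator (cylinder h t) w) = F (g (\<lambda>r. \<omega> r w)) (\<omega> t w)"
    if "w \<in> space M" for w and F :: "('s \<Rightarrow> real^'d \<Rightarrow> ennreal) \<Rightarrow> 's \<Rightarrow> ennreal"
  proof (rule sum_histories[OF that])
    fix h assume h: "\<And>r. r \<le> t \<Longrightarrow> h r = \<omega> r w"
    then have "g h = g (\<lambda>r. \<omega> r w)" by (rule cong)
    then show "F (g h) (h t) = F (g (\<lambda>r. \<omega> r w)) (\<omega> t w)" by (simp add: h)
  qed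
  have cyl: "indicator (cylinder (h(Suc t := j)) (Suc t)) w =
      (indicator (cylinder h t) w * of_bool (j = \<omega> (Suc t) w) :: ennreal)" for h j w
    by (auto simp: cylinder_def indicator_def le_Suc_eq)
  have "(\<integral>\<^sup>+w. g (\<lambda>r. \<omega> r w) (\<omega> (Suc t) w) (x0 w) \<partial>M) =
      (\<integral>\<^sup>+w. (\<Sum>h\<in>?H. g h (\<omega> (Suc t) w) (x0 w) * indicator (cylinder h t) w) \<partial>M)"
    by (intro nn_integral_cong histories[of w "\<lambda>G _. G (\<omega> (Suc t) w) (x0 w)" for w, symmetric])
  also have "\<dots> = (\<integral>\<^sup>+w. (\<Sum>h\<in>?H. \<Sum>j\<in>UNIV.
      g h j (x0 w) * indicator (cylinder (h(Suc t := j)) (Suc t)) w) \<partial>M)"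
    by (simp add: cyl of_bool_def if_distrib mult.assoc[symmetric] del: sum_mult_indicator cong: if_cong)
  \<comment> \<open>Independence separates \<open>x0\<close> from each extended cylinder, whose mass
    is that of the history times one transition probability. The remaining steps reassemble the
    integral.\<close>
  also have "\<dots> = (\<Sum>h\<in>?H. \<Sum>j\<in>UNIV. emeasure M (cylinder h t) * ennreal (p (h t) j) *
      (\<integral>\<^sup>+w. g h j (x0 w) \<partial>M))"
    by (simp add: nn_integral_sum nn_integral_indicator_cylinder emeasure_cylinder_Suc
        del: sum_mult_indicator)
  also have "\<dots> = (\<integral>\<^sup>+w. (\<Sum>h\<in>?H. \<Sum>j\<in>UNIV.
      ennreal (p (h t) j) * (g h j (x0 w) * indicator (cylinder h t) w)) \<partial>M)"
    by (simp add: nn_integral_sum nn_integral_cmult nn_integral_indicator_cylinder mult_ac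
        del: sum_mult_indicator)
  also have "\<dots> = (\<integral>\<^sup>+w. (\<Sum>h\<in>?H. (\<Sum>j\<in>UNIV. ennreal (p (h t) j) * g h j (x0 w)) *
      indicator (cylinder h t) w) \<partial>M)"
    by (simp add: sum_distrib_right mult.assoc del: sum_mult_indicator)
  also have "\<dots> = (\<integral>\<^sup>+w. (\<Sum>j\<in>UNIV. ennreal (p (\<omega> t w) j) * g (\<lambda>r. \<omega> r w) j (x0 w)) \<partial>M)"
    by (intro nn_integral_cong
        histories[of w "\<lambda>G i. \<Sum>j\<in>UNIV. ennreal (p i j) * G j (x0 w)" for w])
  finally show ?thesis .
qed

section \<open>Cost to go of a fixed policy\<close>

abbreviation closed_loop :: "'s \<Rightarrow> real^'d^'d" where
  "closed_loop i \<equiv> A i - B i ** K i"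

text \<open>Iterates, started at 0, of the coupled Lyapunov equations of the closed loop; the index
  is the number of remaining stages.\<close>

primrec value_matrix :: "nat \<Rightarrow> 's \<Rightarrow> real^'d^'d" where
  "value_matrix 0 = (\<lambda>i. 0)"
| "value_matrix (Suc n) = (\<lambda>i. Q i + transpose (K i) ** R i ** K i +
    (\<Sum>j\<in>UNIV. p i j *\<^sub>R (transpose (closed_loop i) ** value_matrix n j ** closed_loop i)))"

definition cost_to_go :: "nat \<Rightarrow> 's \<Rightarrow> real^'d \<Rightarrow> real" where
  "cost_to_go n i x = x \<bullet> (value_matrix n i *v x)"

lemma psd_value_matrix: "psd (value_matrix n i)"
  by (induction n arbitrary: i)
    (auto intro!: psd_add psd_sum psd_scaleR psd_congruence psd_0 simp: Q R p_nonneg)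

lemma cost_to_go_nonneg: "0 \<le> cost_to_go n i x"
  using psd_value_matrix by (simp add: psd_def cost_to_go_def)

lemma stage_cost_feedback:
  "stage_cost Q R i x (feedback K i x) = x \<bullet> ((Q i + transpose (K i) ** R i ** K i) *v x)"
  by (simp add: stage_cost_def feedback_def matrix_vector_mult_add_rdistrib inner_add_right
      inner_congruence linear_neg[OF matrix_vector_mul_linear])

lemma cost_to_go_0 [simp]: "cost_to_go 0 i x = 0"
  by (simp add: cost_to_go_def)

lemma cost_to_go_Suc:
  "cost_to_go (Suc n) i x = stage_cost Q R i x (feedback K i x) +
    (\<Sum>j\<in>UNIV. p i j * cost_to_go n j (closed_loop i *v x))"
  by (simp add: cost_to_go_def stage_cost_feedback matrix_vector_mult_add_rdistrib inner_add_right
      sum_matrix_vector_mult inner_sum_right inner_congruence scaleR_matrix_vector_assoc[symmetric])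

abbreviation state :: "nat \<Rightarrow> 'w \<Rightarrow> real^'d" where
  "state t w \<equiv> trajectory A B K (\<lambda>r. \<omega> r w) (x0 w) t"

definition expected_stage_cost :: "nat \<Rightarrow> ennreal" where
  "expected_stage_cost t =
    (\<integral>\<^sup>+w. ennreal (path_stage_cost A B Q R K (\<lambda>r. \<omega> r w) (x0 w) t) \<partial>M)"

lemma psd_stage_matrix: "psd (Q i + transpose (K i) ** R i ** K i)"
  by (intro psd_add Q psd_congruence R)

lemma path_stage_cost_measurable [measurable]:
  "(\<lambda>w. path_stage_cost A B Q R K (\<lambda>r. \<omega> r w) (x0 w) t) \<in> borel_measurable M"
proof -
  have "(\<lambda>w. stage_cost Q R i (state t w) (feedback K i (state t w))) \<in> borel_measurable M" for i
    unfolding stage_cost_feedback by measurable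
  then show ?thesis
    unfolding path_stage_cost_def Let_def by (rule measurable_compose_countable) measurable
qed

lemma cost_to_go_measurable [measurable]: "cost_to_go n i \<in> borel_measurable borel"
  unfolding cost_to_go_def by measurable

lemma stage_cost_nonneg: "0 \<le> stage_cost Q R i x (feedback K i x)"
  using psd_stage_matrix by (simp add: stage_cost_feedback psd_def)

text \<open>Dynamic programming: \<open>cost_to_go_Suc\<close> splits off the stage at
  \<open>t\<close>, and the Markov property turns the average over \<open>p\<close> into an
  expectation at time \<open>t + 1\<close>. Values in \<open>ennreal\<close> spare all integrability
  conditions.\<close>

lemma expected_cost_to_go:
  "(\<integral>\<^sup>+w. ennreal (cost_to_go n (\<omega> t w) (state t w)) \<partial>M) = (\<Sum>r<n. expected_stage_cost (t + r))"
proof (induction n arbitrary: t)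
  case (Suc n)
  \<comment> \<open>The state at time \<open>t + 1\<close> is determined by \<open>x0\<close> and
    the modes up to \<open>t\<close>, so it may stand inside a function of the history; only the
    next mode \<open>j\<close> is averaged.\<close>
  let ?g = "\<lambda>h j x. ennreal (cost_to_go n j (trajectory A B K h x (Suc t)))"
  have meas: "?g h j \<in> borel_measurable borel" for h j
    using borel_measurable_trajectory[of "\<lambda>x. x" borel "\<lambda>t x. h t" A B K "Suc t"] by measurable
  have "ennreal (cost_to_go (Suc n) (\<omega> t w) (state t w)) =
      ennreal (path_stage_cost A B Q R K (\<lambda>r. \<omega> r w) (x0 w) t) +
      (\<Sum>j\<in>UNIV. ennreal (p (\<omega> t w) j) * ?g (\<lambda>r. \<omega> r w) j (x0 w))" for w
    by (simp only: cost_to_go_Suc trajectory_Suc_closed_loop)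
      (simp add: path_stage_cost_def Let_def p_nonneg cost_to_go_nonneg sum_nonneg
        stage_cost_nonneg ennreal_plus flip: ennreal_mult')
  then have "(\<integral>\<^sup>+w. ennreal (cost_to_go (Suc n) (\<omega> t w) (state t w)) \<partial>M) =
      expected_stage_cost t +
      (\<integral>\<^sup>+w. (\<Sum>j\<in>UNIV. ennreal (p (\<omega> t w) j) * ?g (\<lambda>r. \<omega> r w) j (x0 w)) \<partial>M)"
    unfolding expected_stage_cost_def
    by (simp only:) (rule nn_integral_add, measurable)
  also have "(\<integral>\<^sup>+w. (\<Sum>j\<in>UNIV. ennreal (p (\<omega> t w) j) * ?g (\<lambda>r. \<omega> r w) j (x0 w)) \<partial>M) =
      (\<integral>\<^sup>+w. ?g (\<lambda>r. \<omega> r w) (\<omega> (Suc t) w) (x0 w) \<partial>M)"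
  proof (rule markov_property[symmetric, OF meas])
    fix h h' :: "nat \<Rightarrow> 's" assume "\<And>r. r \<le> t \<Longrightarrow> h r = h' r"
    then have "trajectory A B K h x (Suc t) = trajectory A B K h' x (Suc t)" for x
      by (intro trajectory_cong) simp
    then show "?g h = ?g h'" by (simp only:)
  qed
  also have "\<dots> = (\<Sum>r<n. expected_stage_cost (Suc t + r))" by (rule Suc.IH)
  finally show ?case
    by (simp only: sum.lessThan_Suc_shift) simp
qed simp

lemma truncated_cost_eq: "truncated_cost M \<omega> x0 A B Q R l K = (\<Sum>t<l. expected_stage_cost t)"
  unfolding truncated_cost_def expected_stage_cost_def by (rule nn_integral_sum) measurable

lemma policy_cost_eq: "policy_cost M \<omega> x0 A B Q R K = (\<Sum>t. expected_stage_cost t)"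
  unfolding policy_cost_def expected_stage_cost_def by (rule nn_integral_suminf) measurable

section \<open>From the total cost to tail estimates\<close>

text \<open>Keep only the paths starting in mode \<open>i\<close>. This event is independent of
  \<open>x0\<close> and has probability \<open>\<pi> i\<close>.\<close>

lemma initial_cost_to_go_le:
  "ennreal (\<pi> i) * (\<integral>\<^sup>+w. ennreal (cost_to_go n i (x0 w)) \<partial>M) \<le> policy_cost M \<omega> x0 A B Q R K"
proof -
  have "ennreal (\<pi> i) * (\<integral>\<^sup>+w. ennreal (cost_to_go n i (x0 w)) \<partial>M) =
      (\<integral>\<^sup>+w. ennreal (cost_to_go n i (x0 w)) * indicator (cylinder (\<lambda>_. i) 0) w \<partial>M)"
    using nn_integral_indicator_cylinder[of "\<lambda>x. ennreal (cost_to_go n i x)" "\<lambda>_. i" 0]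
    by (simp add: emeasure_cylinder_0)
  also have "\<dots> \<le> (\<integral>\<^sup>+w. ennreal (cost_to_go n (\<omega> 0 w) (state 0 w)) \<partial>M)"
    by (intro nn_integral_mono) (auto simp: cylinder_def indicator_def)
  also have "\<dots> = (\<Sum>r<n. expected_stage_cost r)"
    unfolding expected_cost_to_go by simp
  also have "\<dots> \<le> policy_cost M \<omega> x0 A B Q R K"
    unfolding policy_cost_eq by (intro sum_le_suminf) auto
  finally show ?thesis .
qed

text \<open>Dividing the averaged bound by \<open>\<pi> i\<close> and comparing with the second
  moment makes it pointwise in \<open>y\<close>; passing to the smallest \<open>\<pi> i\<close>
  makes the constant uniform in the mode.\<close>

lemma cost_to_go_le:
  fixes D :: "(real^'d) measure"
  defines "D \<equiv> distr M borel x0"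
  assumes pi: "\<And>i. 0 < \<pi> i"
    and int: "integrable D (\<lambda>x. columnvector x ** (rowvector x :: real^'d^1))"
    and psd: "psd (second_moment D)"
    and fin: "policy_cost M \<omega> x0 A B Q R K = ennreal c" "0 \<le> c"
  shows "mu_const \<pi> D * cost_to_go n i y \<le> c * (norm y)\<^sup>2"
proof -
  define \<sigma> where "\<sigma> = sigma_min (second_moment D)"
  have "\<sigma> \<in> singular_values (second_moment D)"
    unfolding \<sigma>_def sigma_min_def by (intro Min_in finite_singular_values singular_values_nonempty)
  then have "0 \<le> \<sigma>" by (rule singular_value_nonneg)
  have "ennreal (\<pi> i) * (\<integral>\<^sup>+w. ennreal (cost_to_go n i (x0 w)) \<partial>M) \<le> ennreal (\<pi> i) * ennreal (c / \<pi> i)"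
    using initial_cost_to_go_le[of i n] pi[of i] fin by (simp flip: ennreal_mult')
  then have "(\<integral>\<^sup>+w. ennreal (cost_to_go n i (x0 w)) \<partial>M) \<le> ennreal (c / \<pi> i)"
    using pi[of i] by (subst (asm) ennreal_mult_le_mult_iff) auto
  moreover have "(\<integral>\<^sup>+w. ennreal (cost_to_go n i (x0 w)) \<partial>M) = (\<integral>\<^sup>+x. ennreal (cost_to_go n i x) \<partial>D)"
    unfolding D_def by (subst nn_integral_distr) auto
  ultimately have "(\<integral>\<^sup>+x. ennreal (x \<bullet> (value_matrix n i *v x)) \<partial>D) \<le> ennreal (c / \<pi> i)"
    by (simp add: cost_to_go_def)
  then have "\<sigma> * cost_to_go n i y \<le> (norm y)\<^sup>2 * (c / \<pi> i)"
    unfolding cost_to_go_def \<sigma>_def using pi[of i] fin(2)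
    by (intro quadratic_form_le_expectation int psd psd_value_matrix) (auto simp: D_def)
  then have "\<pi> i * (\<sigma> * cost_to_go n i y) \<le> c * (norm y)\<^sup>2"
    using pi[of i] by (simp add: field_simps)
  moreover have "mu_const \<pi> D * cost_to_go n i y \<le> \<pi> i * (\<sigma> * cost_to_go n i y)"
    using \<open>0 \<le> \<sigma>\<close> cost_to_go_nonneg[of n i y]
    by (simp add: mu_const_def mult.assoc mult_right_mono flip: \<sigma>_def)
  ultimately show ?thesis by simp
qed

lemma stage_cost_ge: "Lambda_min Q * (norm x)\<^sup>2 \<le> stage_cost Q R i x (feedback K i x)"
proof -
  have "Lambda_min Q * (norm x)\<^sup>2 \<le> sigma_min (Q i) * (norm x)\<^sup>2"
    by (intro mult_right_mono Lambda_min_le) simp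
  also have "\<dots> \<le> x \<bullet> (Q i *v x)"
    by (rule sigma_min_le_quadratic_form[OF Q])
  also have "\<dots> \<le> stage_cost Q R i x (feedback K i x)"
    using R by (simp add: stage_cost_def psd_def)
  finally show ?thesis .
qed

text \<open>A stage cost dominates the squared norm of the state, which in turn dominates the cost
  to go, so the future costs at most a fixed multiple of the present stage. The factor does not
  depend on \<open>n\<close>.\<close>

lemma cost_tail_le:
  assumes bound: "\<And>n i y. m * cost_to_go n i y \<le> c * (norm y)\<^sup>2"
    and pos: "0 < m" "0 \<le> c" "0 < Lambda_min Q"
  shows "(\<Sum>r<n. expected_stage_cost (t + r)) \<le> ennreal (c / (m * Lambda_min Q)) * expected_stage_cost t"
proof -
  have *: "cost_to_go n i y \<le> c / (m * Lambda_min Q) * stage_cost Q R i y (feedback K i y)" for i y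
  proof -
    have "(m * Lambda_min Q) * cost_to_go n i y \<le> Lambda_min Q * (c * (norm y)\<^sup>2)"
      using bound[of n i y] pos(3) by (simp add: mult.assoc mult.left_commute)
    also have "\<dots> \<le> c * stage_cost Q R i y (feedback K i y)"
      using mult_left_mono[OF stage_cost_ge pos(2)] by (simp add: mult.left_commute)
    finally show ?thesis
      using pos by (simp add: field_simps)
  qed
  have "(\<Sum>r<n. expected_stage_cost (t + r)) = (\<integral>\<^sup>+w. ennreal (cost_to_go n (\<omega> t w) (state t w)) \<partial>M)"
    by (rule expected_cost_to_go[symmetric])
  also have "\<dots> \<le> (\<integral>\<^sup>+w. ennreal (c / (m * Lambda_min Q)) *
      ennreal (path_stage_cost A B Q R K (\<lambda>r. \<omega> r w) (x0 w) t) \<partial>M)"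
    using * pos by (intro nn_integral_mono)
      (simp add: path_stage_cost_def Let_def ennreal_leI flip: ennreal_mult')
  also have "\<dots> = ennreal (c / (m * Lambda_min Q)) * expected_stage_cost t"
    unfolding expected_stage_cost_def by (rule nn_integral_cmult) measurable
  finally show ?thesis .
qed

lemma truncation_error_le:
  assumes bound: "\<And>n i y. m * cost_to_go n i y \<le> c * (norm y)\<^sup>2"
    and pos: "0 < m" "0 \<le> c" "0 < Lambda_min Q"
    and fin: "policy_cost M \<omega> x0 A B Q R K = ennreal c"
  shows "real l * (c - enn2real (truncated_cost M \<omega> x0 A B Q R l K)) \<le> c\<^sup>2 / (m * Lambda_min Q)"
proof -
  define e where "e t = enn2real (expected_stage_cost t)" for t
  let ?\<kappa> = "c / (m * Lambda_min Q)"
  have "expected_stage_cost t \<le> ennreal c" for t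
  proof -
    have "expected_stage_cost t = (\<Sum>r\<in>{t}. expected_stage_cost r)" by simp
    also have "\<dots> \<le> (\<Sum>r. expected_stage_cost r)" by (intro sum_le_suminf) auto
    finally show ?thesis by (simp add: fin flip: policy_cost_eq)
  qed
  then have e: "expected_stage_cost t = ennreal (e t)" for t
    by (simp add: e_def) (metis ennreal_enn2real ennreal_less_top order_le_less_trans)
  have e_nonneg: "0 \<le> e t" for t by (simp add: e_def)
  have sums: "(\<Sum>t. ennreal (e t)) = ennreal c"
    using fin by (simp add: policy_cost_eq e)
  have summable: "summable e"
    by (rule summable_suminf_not_top) (simp_all add: sums e_nonneg)
  have c: "suminf e = c"
    using sums suminf_ennreal2[OF e_nonneg summable] suminf_nonneg[OF summable e_nonneg] pos(2)
    by simp
  have \<kappa>: "0 \<le> ?\<kappa>" using pos by simp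
  have "(\<Sum>r<n. e (r + t)) \<le> ?\<kappa> * e t" for n t
  proof -
    have "ennreal (\<Sum>r<n. e (r + t)) \<le> ennreal (?\<kappa> * e t)"
      using cost_tail_le[OF bound pos, where n = n and t = t]
      by (simp only: ennreal_mult[OF \<kappa> e_nonneg]) (simp add: e e_nonneg add.commute)
    then show ?thesis
      by (subst (asm) ennreal_le_iff) (intro mult_nonneg_nonneg \<kappa> e_nonneg)
  qed
  \<comment> \<open>The bound is uniform in the horizon \<open>n\<close>, so it passes to the
    infinite tail.\<close>
  then have "(\<Sum>r. e (r + t)) \<le> ?\<kappa> * e t" for t
    using summable by (intro suminf_le_const) (simp_all add: summable_iff_shift)
  then have "real l * (\<Sum>r. e (r + l)) \<le> ?\<kappa> * suminf e"
    by (intro tail_le_of_proportional_tails summable e_nonneg \<kappa>)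
  moreover have "enn2real (truncated_cost M \<omega> x0 A B Q R l K) = (\<Sum>t<l. e t)"
    by (simp add: truncated_cost_eq e e_nonneg sum_nonneg)
  ultimately show ?thesis
    using suminf_split_initial_segment[OF summable, of l]
    by (simp add: c power2_eq_square algebra_simps)
qed

end

theorem lemma1:
  fixes M :: "'w measure"
    and \<omega> :: "nat \<Rightarrow> 'w \<Rightarrow> 's::finite"
    and \<pi> :: "'s \<Rightarrow> real"
    and p :: "'s \<Rightarrow> 's \<Rightarrow> real"
    and x0 :: "'w \<Rightarrow> real^'d"
    and D :: "(real^'d) measure"
    and A :: "'s \<Rightarrow> real^'d^'d"
    and B :: "'s \<Rightarrow> real^'k^'d"
    and Q :: "'s \<Rightarrow> real^'d^'d"
    and R :: "'s \<Rightarrow> real^'k^'k"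
    and K :: "'s \<Rightarrow> real^'d^'k"
    and \<epsilon> :: real
    and l :: nat
  assumes "markov_chain M \<omega> \<pi> p"
    and "x0 \<in> borel_measurable M"
    and "distr M borel x0 = D"
    and "independent_rvs M borel x0 (Pi\<^sub>M UNIV (\<lambda>_. count_space UNIV)) (\<lambda>w t. \<omega> t w)"
    and "\<And>i. positive_definite (Q i)"
    and "\<And>i. positive_definite (R i)"
    and "\<And>i. 0 < \<pi> i"
    and "integrable D (\<lambda>x. columnvector x ** (rowvector x :: real^'d^1))"
    and "positive_definite (second_moment D)"
    and "mean_square_stabilizable A B p"
    and "0 < \<epsilon>"
    and "policy_cost M \<omega> x0 A B Q R K < \<infinity>"
    and "real l \<ge>
           real CARD('d) * (enn2real (policy_cost M \<omega> x0 A B Q R K))\<^sup>2 *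
             (\<Sum>i\<in>UNIV. sigma_max (Q i) + sigma_max (R i) * (sigma_max (K i))\<^sup>2)
           / (\<epsilon> * mu_const \<pi> D * (Lambda_min Q)\<^sup>2)"
  shows "enn2real (policy_cost M \<omega> x0 A B Q R K) -
           enn2real (truncated_cost M \<omega> x0 A B Q R l K) \<le> \<epsilon>"
proof -
  interpret markov_jump_system M \<omega> \<pi> p x0 A B Q R K
    using assms(1,4,5,6) by unfold_locales (simp_all add: positive_definite_imp_psd)
  define c where "c = enn2real (policy_cost M \<omega> x0 A B Q R K)"
  define S where "S = (\<Sum>i\<in>UNIV. sigma_max (Q i) + sigma_max (R i) * (sigma_max (K i))\<^sup>2)"
  define \<mu> where "\<mu> = mu_const \<pi> D"
  define \<Lambda> where "\<Lambda> = Lambda_min Q"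
  define T where "T = enn2real (truncated_cost M \<omega> x0 A B Q R l K)"
  have C: "policy_cost M \<omega> x0 A B Q R K = ennreal c" and c: "0 \<le> c"
    using assms(12) by (simp_all add: c_def)
  have \<Lambda>: "0 < \<Lambda>" unfolding \<Lambda>_def by (rule Lambda_min_pos) (rule assms)
  have \<mu>: "0 < \<mu>"
    using assms(7) sigma_min_pos[OF assms(9)] by (simp add: \<mu>_def mu_const_def)
  have "\<mu> * cost_to_go n i y \<le> c * (norm y)\<^sup>2" for n i y
    unfolding \<mu>_def assms(3)[symmetric]
    by (rule cost_to_go_le)
      (use assms(7,8,9) C c in \<open>simp_all add: assms(3) positive_definite_imp_psd\<close>)
  note err = truncation_error_le[OF this \<mu> c \<Lambda>[unfolded \<Lambda>_def] C, of l, folded T_def \<Lambda>_def]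
  \<comment> \<open>A single mode already suffices: its summand contains the largest singular value
    of its \<open>Q i\<close>. Together with \<open>CARD('d)\<close> at least 1, this makes the
    prescribed horizon at least \<open>c\<^sup>2 / (\<epsilon> * \<mu> * \<Lambda>)\<close>.\<close>
  have "\<Lambda> \<le> S"
  proof -
    fix i :: 's
    have "\<Lambda> \<le> sigma_max (Q i)"
      using Lambda_min_le[of Q i] sigma_min_le_sigma_max[of "Q i"] by (simp add: \<Lambda>_def)
    also have "\<dots> \<le> sigma_max (Q i) + sigma_max (R i) * (sigma_max (K i))\<^sup>2"
      by (simp add: sigma_max_nonneg)
    also have "\<dots> \<le> S"
      unfolding S_def by (rule member_le_sum) (simp_all add: sigma_max_nonneg)
    finally show ?thesis .
  qed
  moreover have "1 \<le> real CARD('d)"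
    by (simp add: Suc_le_eq)
  ultimately have "1 * \<Lambda> \<le> real CARD('d) * S"
    using \<Lambda> by (intro mult_mono) auto
  then have "c\<^sup>2 / (\<epsilon> * \<mu> * \<Lambda>) \<le> real CARD('d) * c\<^sup>2 * S / (\<epsilon> * \<mu> * \<Lambda>\<^sup>2)"
    using \<Lambda> \<mu> assms(11) mult_left_mono[of \<Lambda> "real CARD('d) * S" "c\<^sup>2"]
    by (simp add: field_simps power2_eq_square)
  also have "\<dots> \<le> real l"
    using assms(13) by (simp add: c_def S_def \<mu>_def \<Lambda>_def)
  finally have l: "c\<^sup>2 / (\<mu> * \<Lambda>) \<le> real l * \<epsilon>"
    using \<Lambda> \<mu> assms(11) by (simp add: field_simps)
  show ?thesis
  \<comment> \<open>The estimate has to be divided by \<open>l\<close>. If \<open>l = 0\<close>, the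
    horizon condition itself forces the cost to be 0.\<close>
  proof (cases "l = 0")
    case True
    with l have "c\<^sup>2 \<le> 0" using \<Lambda> \<mu> by (simp add: field_simps)
    then have "c = 0" by simp
    moreover have "0 \<le> T" by (simp add: T_def)
    ultimately have "c - T \<le> \<epsilon>" using assms(11) by linarith
    then show ?thesis by (simp only: c_def T_def)
  next
    case False
    have "real l * (c - T) \<le> real l * \<epsilon>" using err l by linarith
    then have "c - T \<le> \<epsilon>" using False by simp
    then show ?thesis by (simp only: c_def T_def)
  qed
qed

end
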